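(* Let $G$ and $H$ be equivalent locally compact Hausdorff groupoids with open range and source maps. Then: (a) $G$ is strongly topologically principal if and only if $H$ is strongly topologically principal. (b) $G$ is strongly essentially principal if and only if $H$ is strongly essentially principal.
   Context: Groupoids are topological groupoids, not assumed second countable and not assumed to have Haar systems. $G^{(0)}$ is the unit space of $G$, and $r,s:G\to G^{(0)}$ are the range and source maps. Actions: a left action of $G$ on a space $P$ consists of a continuous moment map $r_P:P\to G^{(0)}$ and a continuous map $(\gamma,p)\mapsto\gamma\cdot p$ from $G*P=\{(\gamma,p): s(\gamma)=r_P(p)\}$ to $P$ with $r_P(\gamma\cdot p)=r(\gamma)$, $r_P(p)\cdot p=p$ and $\gamma\cdot(\eta\cdot p)=(\gamma\eta)\cdot p$ for composable $\gamma,\eta$. The action is free if $\gamma\cdot p=p$ only when $\gamma=r_P(p)$. It is proper if the map $\Theta:G*P\to P\times P$, $\Theta(\gamma,p)=(\gamma\cdot p,p)$, is proper (preimages of compact sets are compact). Right actions are defined similarly, with moment map $s_P$. Equivalence: $G$ and $H$ are equivalent if there is a $(G,H)$-equivalence, i.e. a locally compact Hausdorff space $Z$ such that: (E1) $Z$ is a free and proper left $G$-space; (E2) $Z$ is a free and proper right $H$-space; (E3) the two actions commute; (E4) the moment map $r_Z:Z\to G^{(0)}$ is open and induces a homeomorphism $Z/H\to G^{(0)}$; (E5) the moment map $s_Z:Z\to H^{(0)}$ is open and induces a homeomorphism $G\backslash Z\to H^{(0)}$. For $u\in G^{(0)}$ the isotropy group is $G(u)=\{\gamma\in G: r(\gamma)=u=s(\gamma)\}$.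 The isotropy of $G$ is discretely trivial at $v\in G^{(0)}$ if for every compact set $K\subset G$ there is a neighborhood $V$ of $v$ in $G^{(0)}$ such that $u\in V$ implies $K\cap G(u)\subset\{u\}$. A subset $F\subset G^{(0)}$ is $G$-invariant if, for all $\gamma\in G$, $r(\gamma)\in F$ if and only if $s(\gamma)\in F$. $G$ is strongly topologically principal if the set of points of $G^{(0)}$ at which the isotropy of $G$ is discretely trivial is dense in $G^{(0)}$. $G$ is strongly essentially principal if the points with discretely trivial isotropy are dense in every closed $G$-invariant subset of $G^{(0)}$ (for closed $G$-invariant $F$, the set of points of $F$ at which the isotropy is discretely trivial is dense in $F$). *)

theory Defs
  imports "HOL-Analysis.Analysis"
begin

section \<open>Topological groupoids\<close>

text \<open>
  A groupoid is given by its space of arrows. Units are identified with their identity arrows,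
  so that the unit space is a subset of the space of arrows. Multiplication is only meaningful on
  composable pairs \<open>(a, b)\<close>, i.e. those with \<open>src a = rng b\<close>; outside of them, and outside of
  the space of arrows, the record fields are unconstrained.
\<close>

record 'g groupoid_data =
  arrows :: "'g topology"
  rng :: "'g \<Rightarrow> 'g"
  src :: "'g \<Rightarrow> 'g"
  gmult :: "'g \<Rightarrow> 'g \<Rightarrow> 'g"
  ginv :: "'g \<Rightarrow> 'g"

definition units :: "('g, 'e) groupoid_data_scheme \<Rightarrow> 'g set" where
  "units G = rng G ` topspace (arrows G)"

definition unit_space :: "('g, 'e) groupoid_data_scheme \<Rightarrow> 'g topology" where
  "unit_space G = subtopology (arrows G) (units G)"

definition composable_pairs :: "('g, 'e) groupoid_data_scheme \<Rightarrow> ('g \<times> 'g) topology" where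
  "composable_pairs G =
     subtopology (prod_topology (arrows G) (arrows G)) {(a, b). src G a = rng G b}"

text \<open>
  Continuity of \<open>rng\<close> and \<open>src\<close> follows from that of multiplication and inversion, since
  \<open>rng a = a a\<^sup>-\<^sup>1\<close> and \<open>src a = a\<^sup>-\<^sup>1 a\<close>.
\<close>

locale topological_groupoid =
  fixes G :: "('g, 'e) groupoid_data_scheme"
  assumes rng_closed: "a \<in> topspace (arrows G) \<Longrightarrow> rng G a \<in> topspace (arrows G)"
    and src_in_units: "a \<in> topspace (arrows G) \<Longrightarrow> src G a \<in> units G"
    and rng_unit: "u \<in> units G \<Longrightarrow> rng G u = u"
    and src_unit: "u \<in> units G \<Longrightarrow> src G u = u"
    and mult_closed: "\<lbrakk>a \<in> topspace (arrows G); b \<in> topspace (arrows G); src G a = rng G b\<rbrakk>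
          \<Longrightarrow> gmult G a b \<in> topspace (arrows G)"
    and rng_mult: "\<lbrakk>a \<in> topspace (arrows G); b \<in> topspace (arrows G); src G a = rng G b\<rbrakk>
          \<Longrightarrow> rng G (gmult G a b) = rng G a"
    and src_mult: "\<lbrakk>a \<in> topspace (arrows G); b \<in> topspace (arrows G); src G a = rng G b\<rbrakk>
          \<Longrightarrow> src G (gmult G a b) = src G b"
    and mult_assoc: "\<lbrakk>a \<in> topspace (arrows G); b \<in> topspace (arrows G); c \<in> topspace (arrows G);
            src G a = rng G b; src G b = rng G c\<rbrakk>
          \<Longrightarrow> gmult G (gmult G a b) c = gmult G a (gmult G b c)"
    and left_unit: "a \<in> topspace (arrows G) \<Longrightarrow> gmult G (rng G a) a = a"
    and right_unit: "a \<in> topspace (arrows G) \<Longrightarrow> gmult G a (src G a) = a"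
    and inv_closed: "a \<in> topspace (arrows G) \<Longrightarrow> ginv G a \<in> topspace (arrows G)"
    and rng_inv: "a \<in> topspace (arrows G) \<Longrightarrow> rng G (ginv G a) = src G a"
    and src_inv: "a \<in> topspace (arrows G) \<Longrightarrow> src G (ginv G a) = rng G a"
    and right_inv: "a \<in> topspace (arrows G) \<Longrightarrow> gmult G a (ginv G a) = rng G a"
    and left_inv: "a \<in> topspace (arrows G) \<Longrightarrow> gmult G (ginv G a) a = src G a"
    and continuous_mult:
          "continuous_map (composable_pairs G) (arrows G) (\<lambda>(a, b). gmult G a b)"
    and continuous_inv: "continuous_map (arrows G) (arrows G) (ginv G)"

section \<open>Actions\<close>

definition left_fibre_product ::
  "('g, 'e) groupoid_data_scheme \<Rightarrow> 'p topology \<Rightarrow> ('p \<Rightarrow> 'g) \<Rightarrow> ('g \<times> 'p) topology" where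
  "left_fibre_product G P rP =
     subtopology (prod_topology (arrows G) P) {(a, p). src G a = rP p}"

definition right_fibre_product ::
  "('g, 'e) groupoid_data_scheme \<Rightarrow> 'p topology \<Rightarrow> ('p \<Rightarrow> 'g) \<Rightarrow> ('p \<times> 'g) topology" where
  "right_fibre_product G P sP =
     subtopology (prod_topology P (arrows G)) {(p, a). sP p = rng G a}"

text \<open>
  The library's \<^const>\<open>proper_map\<close> asks for a closed map with compact fibres; here properness
  means that preimages of compact sets are compact.
\<close>

definition compact_preimages :: "'a topology \<Rightarrow> 'b topology \<Rightarrow> ('a \<Rightarrow> 'b) \<Rightarrow> bool" where
  "compact_preimages X Y f \<longleftrightarrow>
     (\<forall>K. compactin Y K \<longrightarrow> compactin X {x \<in> topspace X. f x \<in> K})"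

locale left_action = topological_groupoid G
  for G :: "('g, 'e) groupoid_data_scheme" +
  fixes P :: "'p topology" and rP :: "'p \<Rightarrow> 'g" and act :: "'g \<Rightarrow> 'p \<Rightarrow> 'p"
  assumes continuous_moment: "continuous_map P (unit_space G) rP"
    and continuous_act: "continuous_map (left_fibre_product G P rP) P (\<lambda>(a, p). act a p)"
    and moment_act: "\<lbrakk>a \<in> topspace (arrows G); p \<in> topspace P; src G a = rP p\<rbrakk>
          \<Longrightarrow> rP (act a p) = rng G a"
    and unit_act: "p \<in> topspace P \<Longrightarrow> act (rP p) p = p"
    and mult_act: "\<lbrakk>a \<in> topspace (arrows G); b \<in> topspace (arrows G); p \<in> topspace P;
            src G a = rng G b; src G b = rP p\<rbrakk>
          \<Longrightarrow> act a (act b p) = act (gmult G a b) p"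

locale free_proper_left_action = left_action +
  assumes free: "\<lbrakk>a \<in> topspace (arrows G); p \<in> topspace P; src G a = rP p; act a p = p\<rbrakk>
          \<Longrightarrow> a = rP p"
    and proper: "compact_preimages (left_fibre_product G P rP) (prod_topology P P)
          (\<lambda>(a, p). (act a p, p))"

locale right_action = topological_groupoid G
  for G :: "('g, 'e) groupoid_data_scheme" +
  fixes P :: "'p topology" and sP :: "'p \<Rightarrow> 'g" and act :: "'p \<Rightarrow> 'g \<Rightarrow> 'p"
  assumes continuous_moment: "continuous_map P (unit_space G) sP"
    and continuous_act: "continuous_map (right_fibre_product G P sP) P (\<lambda>(p, a). act p a)"
    and moment_act: "\<lbrakk>a \<in> topspace (arrows G); p \<in> topspace P; sP p = rng G a\<rbrakk>
          \<Longrightarrow> sP (act p a) = src G a"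
    and unit_act: "p \<in> topspace P \<Longrightarrow> act p (sP p) = p"
    and mult_act: "\<lbrakk>a \<in> topspace (arrows G); b \<in> topspace (arrows G); p \<in> topspace P;
            sP p = rng G a; src G a = rng G b\<rbrakk>
          \<Longrightarrow> act (act p a) b = act p (gmult G a b)"

locale free_proper_right_action = right_action +
  assumes free: "\<lbrakk>a \<in> topspace (arrows G); p \<in> topspace P; sP p = rng G a; act p a = p\<rbrakk>
          \<Longrightarrow> a = sP p"
    and proper: "compact_preimages (right_fibre_product G P sP) (prod_topology P P)
          (\<lambda>(p, a). (act p a, p))"

section \<open>Orbit spaces\<close>

definition quotient_topology :: "'a topology \<Rightarrow> ('a \<Rightarrow> 'b) \<Rightarrow> 'b topology" where
  "quotient_topology X q =
     topology (\<lambda>U. U \<subseteq> q ` topspace X \<and> openin X {x \<in> topspace X. q x \<in> U})"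

lemma openin_quotient_topology:
  "openin (quotient_topology X q) U \<longleftrightarrow>
     U \<subseteq> q ` topspace X \<and> openin X {x \<in> topspace X. q x \<in> U}"
proof -
  have "istopology (\<lambda>U. U \<subseteq> q ` topspace X \<and> openin X {x \<in> topspace X. q x \<in> U})"
    unfolding istopology_def
  proof (intro conjI allI impI)
    fix S T
    assume S: "S \<subseteq> q ` topspace X \<and> openin X {x \<in> topspace X. q x \<in> S}"
      and T: "T \<subseteq> q ` topspace X \<and> openin X {x \<in> topspace X. q x \<in> T}"
    show "S \<inter> T \<subseteq> q ` topspace X" using S by blast
    have "{x \<in> topspace X. q x \<in> S \<inter> T} =
        {x \<in> topspace X. q x \<in> S} \<inter> {x \<in> topspace X. q x \<in> T}" by blast
    then show "openin X {x \<in> topspace X. q x \<in> S \<inter> T}" using S T by auto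
  next
    fix \<K>
    assume K: "\<forall>K\<in>\<K>. K \<subseteq> q ` topspace X \<and> openin X {x \<in> topspace X. q x \<in> K}"
    show "\<Union>\<K> \<subseteq> q ` topspace X" using K by blast
    have "{x \<in> topspace X. q x \<in> \<Union>\<K>} = (\<Union>K\<in>\<K>. {x \<in> topspace X. q x \<in> K})" by blast
    then show "openin X {x \<in> topspace X. q x \<in> \<Union>\<K>}" using K by auto
  qed
  then show ?thesis
    by (simp add: quotient_topology_def)
qed

definition left_orbit ::
  "('g, 'e) groupoid_data_scheme \<Rightarrow> ('p \<Rightarrow> 'g) \<Rightarrow> ('g \<Rightarrow> 'p \<Rightarrow> 'p) \<Rightarrow> 'p \<Rightarrow> 'p set" where
  "left_orbit G rP act p = {act a p | a. a \<in> topspace (arrows G) \<and> src G a = rP p}"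

definition right_orbit ::
  "('g, 'e) groupoid_data_scheme \<Rightarrow> ('p \<Rightarrow> 'g) \<Rightarrow> ('p \<Rightarrow> 'g \<Rightarrow> 'p) \<Rightarrow> 'p \<Rightarrow> 'p set" where
  "right_orbit G sP act p = {act p a | a. a \<in> topspace (arrows G) \<and> sP p = rng G a}"

definition induces_homeomorphism ::
  "'a topology \<Rightarrow> ('a \<Rightarrow> 'b) \<Rightarrow> 'c topology \<Rightarrow> ('a \<Rightarrow> 'c) \<Rightarrow> bool" where
  "induces_homeomorphism X q Y f \<longleftrightarrow>
     (\<exists>h. homeomorphic_map (quotient_topology X q) Y h \<and> (\<forall>x \<in> topspace X. h (q x) = f x))"

section \<open>Equivalence of groupoids\<close>

text \<open>
  The identities \<open>sZ (a \<cdot> z) = sZ z\<close> and \<open>rZ (z \<cdot> b) = rZ z\<close> are part of the actions commuting: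
  they make both sides of \<open>(a \<cdot> z) \<cdot> b = a \<cdot> (z \<cdot> b)\<close> defined. They also follow from
  the moment maps factoring through the orbit spaces.
\<close>

locale groupoid_equivalence =
  left: free_proper_left_action G Z rZ lact + right: free_proper_right_action H Z sZ ract
  for G :: "('g, 'e) groupoid_data_scheme" and H :: "('h, 'f) groupoid_data_scheme"
    and Z :: "'z topology"
    and rZ :: "'z \<Rightarrow> 'g" and lact :: "'g \<Rightarrow> 'z \<Rightarrow> 'z"
    and sZ :: "'z \<Rightarrow> 'h" and ract :: "'z \<Rightarrow> 'h \<Rightarrow> 'z" +
  assumes locally_compact_Z: "locally_compact_space Z"
    and Hausdorff_Z: "Hausdorff_space Z"
    and sZ_lact: "\<lbrakk>a \<in> topspace (arrows G); z \<in> topspace Z; src G a = rZ z\<rbrakk>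
          \<Longrightarrow> sZ (lact a z) = sZ z"
    and rZ_ract: "\<lbrakk>b \<in> topspace (arrows H); z \<in> topspace Z; sZ z = rng H b\<rbrakk>
          \<Longrightarrow> rZ (ract z b) = rZ z"
    and actions_commute: "\<lbrakk>a \<in> topspace (arrows G); z \<in> topspace Z; b \<in> topspace (arrows H);
            src G a = rZ z; sZ z = rng H b\<rbrakk>
          \<Longrightarrow> ract (lact a z) b = lact a (ract z b)"
    and open_rZ: "open_map Z (unit_space G) rZ"
    and homeo_rZ: "induces_homeomorphism Z (right_orbit H sZ ract) (unit_space G) rZ"
    and open_sZ: "open_map Z (unit_space H) sZ"
    and homeo_sZ: "induces_homeomorphism Z (left_orbit G rZ lact) (unit_space H) sZ"

section \<open>Isotropy\<close>

definition isotropy_group :: "('g, 'e) groupoid_data_scheme \<Rightarrow> 'g \<Rightarrow> 'g set" where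
  "isotropy_group G u = {a \<in> topspace (arrows G). rng G a = u \<and> src G a = u}"

definition isotropy_discretely_trivial_at ::
  "('g, 'e) groupoid_data_scheme \<Rightarrow> 'g \<Rightarrow> bool" where
  "isotropy_discretely_trivial_at G v \<longleftrightarrow>
     v \<in> units G \<and>
     (\<forall>K. compactin (arrows G) K \<longrightarrow>
        (\<exists>V. openin (unit_space G) V \<and> v \<in> V \<and> (\<forall>u\<in>V. K \<inter> isotropy_group G u \<subseteq> {u})))"

definition invariant_subset :: "('g, 'e) groupoid_data_scheme \<Rightarrow> 'g set \<Rightarrow> bool" where
  "invariant_subset G F \<longleftrightarrow>
     F \<subseteq> units G \<and> (\<forall>a \<in> topspace (arrows G). rng G a \<in> F \<longleftrightarrow> src G a \<in> F)"

definition strongly_topologically_principal :: "('g, 'e) groupoid_data_scheme \<Rightarrow> bool" where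
  "strongly_topologically_principal G \<longleftrightarrow>
     unit_space G closure_of {v \<in> units G. isotropy_discretely_trivial_at G v} = units G"

text \<open>
  In the next definition it is the isotropy of \<open>G\<close>, and not that of its reduction to \<open>F\<close>, that
  is required to be discretely trivial.
\<close>

definition strongly_essentially_principal :: "('g, 'e) groupoid_data_scheme \<Rightarrow> bool" where
  "strongly_essentially_principal G \<longleftrightarrow>
     (\<forall>F. closedin (unit_space G) F \<and> invariant_subset G F \<longrightarrow>
        subtopology (unit_space G) F closure_of {v \<in> F. isotropy_discretely_trivial_at G v} = F)"

end

theory Submission
  imports Defs
begin

text \<open>
  For \<open>z\<close> in an equivalence \<open>Z\<close>, the isotropy of \<open>G\<close> is discretely trivial at \<open>rZ z\<close> iff that of
  \<open>H\<close> is at \<open>sZ z\<close>. Indeed, for \<open>z'\<close> in a compact neighbourhood \<open>W\<close> of \<open>z\<close> and \<open>b\<close> in a compact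
  subset \<open>K\<close> of \<open>H\<close> that is isotropy at \<open>sZ z'\<close>, one has \<open>z' \<cdot> b = a \<cdot> z'\<close> for an \<open>a\<close> in the
  isotropy at \<open>rZ z'\<close>, and by properness all such \<open>a\<close> lie in one compact subset of \<open>G\<close>; if \<open>a\<close> is
  a unit, so is \<open>b\<close> by freeness. Since the moment maps are open and continuous, density then passes
  through the correspondence \<open>F \<mapsto> rZ (sZ\<^sup>-\<^sup>1 F)\<close> of closed invariant sets.
\<close>

section \<open>Inverses in a groupoid, and inversion as a swap of left and right fibre products and
  orbits\<close>

context topological_groupoid
begin

lemma units_subset_arrows: "units G \<subseteq> topspace (arrows G)"
  using rng_closed by (auto simp: units_def)

lemma topspace_unit_space [simp]: "topspace (unit_space G) = units G"
  using units_subset_arrows by (auto simp: unit_space_def)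

lemma rng_in_units: "a \<in> topspace (arrows G) \<Longrightarrow> rng G a \<in> units G"
  by (simp add: units_def)

text \<open>Inserting a unit and reassociating gives b = (a^-1 a) b = a^-1 (a b) = a^-1. The rules
  for inverses of inverses, units and products are all obtained by checking these
  hypotheses.\<close>

lemma eq_ginvI:
  assumes a: "a \<in> topspace (arrows G)" and b: "b \<in> topspace (arrows G)"
    and ab: "src G a = rng G b" "gmult G a b = rng G a"
  shows "b = ginv G a"
proof -
  have "b = gmult G (gmult G (ginv G a) a) b"
    using a b ab by (simp add: left_inv left_unit)
  also have "\<dots> = gmult G (ginv G a) (gmult G a b)"
    using a b ab by (simp add: mult_assoc inv_closed src_inv)
  also have "\<dots> = gmult G (ginv G a) (src G (ginv G a))"
    using a ab by (simp add: src_inv)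
  also have "\<dots> = ginv G a"
    using a by (simp only: right_unit inv_closed)
  finally show ?thesis .
qed

lemma ginv_ginv: "a \<in> topspace (arrows G) \<Longrightarrow> ginv G (ginv G a) = a"
  by (rule eq_ginvI [symmetric]) (simp_all add: inv_closed src_inv rng_inv left_inv)

lemma ginv_unit:
  assumes "u \<in> units G"
  shows "ginv G u = u"
proof (rule eq_ginvI [symmetric])
  show u: "u \<in> topspace (arrows G)" "u \<in> topspace (arrows G)"
    using assms units_subset_arrows by auto
  show "src G u = rng G u" "gmult G u u = rng G u"
    using assms left_unit [OF u(1)] by (simp_all add: rng_unit src_unit)
qed

lemma ginv_gmult:
  assumes a: "a \<in> topspace (arrows G)" and b: "b \<in> topspace (arrows G)"
    and ab: "src G a = rng G b"
  shows "ginv G (gmult G a b) = gmult G (ginv G b) (ginv G a)"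
proof (rule eq_ginvI [symmetric])
  have c: "gmult G (ginv G b) (ginv G a) \<in> topspace (arrows G)"
      "rng G (gmult G (ginv G b) (ginv G a)) = src G b"
    using a b ab by (simp_all add: mult_closed inv_closed rng_inv src_inv rng_mult)
  \<comment> \<open>The inner cancellation b (b^-1 a^-1) = a^-1 is done first, so that only a a^-1
    remains in the full product.\<close>
  have "gmult G b (gmult G (ginv G b) (ginv G a)) = gmult G (gmult G b (ginv G b)) (ginv G a)"
    using a b ab by (simp add: mult_assoc inv_closed rng_inv src_inv)
  also have "\<dots> = gmult G (rng G (ginv G a)) (ginv G a)"
    using a b ab by (simp add: right_inv rng_inv)
  also have "\<dots> = ginv G a"
    using a by (simp only: left_unit inv_closed)
  finally have "gmult G b (gmult G (ginv G b) (ginv G a)) = ginv G a" .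
  then show "gmult G (gmult G a b) (gmult G (ginv G b) (ginv G a)) = rng G (gmult G a b)"
    using a b ab c by (simp add: mult_assoc rng_mult right_inv)
  show "src G (gmult G a b) = rng G (gmult G (ginv G b) (ginv G a))"
    using a b ab c by (simp add: src_mult)
qed (use a b ab in \<open>simp_all add: mult_closed inv_closed rng_inv src_inv\<close>)

text \<open>Inversion exchanges source and range, so the condition \<open>src G a = m p\<close>
  becomes \<open>m p = rng G (ginv G a)\<close>. This swap and the opposite one below are inverse to
  each other; they carry continuity and properness of an action from one side to the other.\<close>

lemma continuous_map_left_to_right_fibre_product:
  "continuous_map (left_fibre_product G P m) (right_fibre_product G P m) (\<lambda>(a, p). (p, ginv G a))"
proof -
  have "continuous_map (prod_topology (arrows G) P) (prod_topology P (arrows G))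
          (\<lambda>x. (snd x, (ginv G \<circ> fst) x))"
    by (intro continuous_map_pairedI continuous_map_snd
        continuous_map_compose [OF continuous_map_fst continuous_inv])
  then show ?thesis
    unfolding left_fibre_product_def right_fibre_product_def
    by (auto simp: continuous_map_in_subtopology case_prod_unfold comp_def rng_inv
        intro: continuous_map_from_subtopology)
qed

lemma continuous_map_right_to_left_fibre_product:
  "continuous_map (right_fibre_product G P m) (left_fibre_product G P m) (\<lambda>(p, a). (ginv G a, p))"
proof -
  have "continuous_map (prod_topology P (arrows G)) (prod_topology (arrows G) P)
          (\<lambda>x. ((ginv G \<circ> snd) x, fst x))"
    by (intro continuous_map_pairedI continuous_map_fst
        continuous_map_compose [OF continuous_map_snd continuous_inv])
  then show ?thesis
    unfolding left_fibre_product_def right_fibre_product_def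
    by (auto simp: continuous_map_in_subtopology case_prod_unfold comp_def src_inv
        intro: continuous_map_from_subtopology)
qed

lemma topspace_left_fibre_product:
  "topspace (left_fibre_product G P m) =
     {(a, p). a \<in> topspace (arrows G) \<and> p \<in> topspace P \<and> src G a = m p}"
  by (auto simp: left_fibre_product_def)

lemma topspace_right_fibre_product:
  "topspace (right_fibre_product G P m) =
     {(p, a). p \<in> topspace P \<and> a \<in> topspace (arrows G) \<and> m p = rng G a}"
  by (auto simp: right_fibre_product_def)

text \<open>Inversion is a bijection from the arrows with source \<open>m p\<close> to those with
  range \<open>m p\<close>, so both actions sweep out the same set.\<close>

lemma left_orbit_inverse_action:
  "left_orbit G m (\<lambda>a p. act p (ginv G a)) = right_orbit G m act"
proof (intro ext set_eqI iffI)
  fix p x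
  assume "x \<in> left_orbit G m (\<lambda>a p. act p (ginv G a)) p"
  then show "x \<in> right_orbit G m act p"
    unfolding left_orbit_def right_orbit_def by (auto simp: rng_inv) (metis inv_closed rng_inv)
next
  fix p x
  assume "x \<in> right_orbit G m act p"
  then obtain a where "x = act p a" "a \<in> topspace (arrows G)" "m p = rng G a"
    unfolding right_orbit_def by auto
  then show "x \<in> left_orbit G m (\<lambda>a p. act p (ginv G a)) p"
    unfolding left_orbit_def
    by (auto intro!: exI [of _ "ginv G a"] simp: ginv_ginv inv_closed src_inv)
qed

lemma right_orbit_inverse_action:
  "right_orbit G m (\<lambda>p a. act (ginv G a) p) = left_orbit G m act"
proof (intro ext set_eqI iffI)
  fix p x
  assume "x \<in> right_orbit G m (\<lambda>p a. act (ginv G a) p) p"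
  then show "x \<in> left_orbit G m act p"
    unfolding left_orbit_def right_orbit_def by (auto simp: src_inv) (metis inv_closed src_inv)
next
  fix p x
  assume "x \<in> left_orbit G m act p"
  then obtain a where "x = act a p" "a \<in> topspace (arrows G)" "src G a = m p"
    unfolding left_orbit_def by auto
  then show "x \<in> right_orbit G m (\<lambda>p a. act (ginv G a) p) p"
    unfolding right_orbit_def
    by (auto intro!: exI [of _ "ginv G a"] simp: ginv_ginv inv_closed rng_inv)
qed

end

section \<open>Changing the side of a free and proper action\<close>

lemma (in left_action) moment_in_units: "p \<in> topspace P \<Longrightarrow> rP p \<in> units G"
  using continuous_map_image_subset_topspace [OF continuous_moment] by auto

lemma (in right_action) moment_in_units: "p \<in> topspace P \<Longrightarrow> sP p \<in> units G"
  using continuous_map_image_subset_topspace [OF continuous_moment] by auto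

text \<open>Letting a act through a^-1 turns a right action into a left one because inversion
  reverses products. Freeness survives since an arrow whose inverse is a unit is that unit.\<close>

lemma (in free_proper_right_action) free_proper_left_action_inverse:
  "free_proper_left_action G P sP (\<lambda>a p. act p (ginv G a))"
proof
  show "continuous_map P (unit_space G) sP"
    by (rule continuous_moment)
  show "continuous_map (left_fibre_product G P sP) P (\<lambda>(a, p). act p (ginv G a))"
    using continuous_map_compose [OF continuous_map_left_to_right_fibre_product continuous_act]
    by (simp add: case_prod_unfold comp_def)
  fix a p
  assume a: "a \<in> topspace (arrows G)" and p: "p \<in> topspace P" and ap: "src G a = sP p"
  show "sP (act p (ginv G a)) = rng G a"
    using a p ap by (simp add: moment_act inv_closed rng_inv src_inv)
  assume "act p (ginv G a) = p"
  then have "ginv G a = sP p"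
    using a p ap free [of "ginv G a" p] by (simp add: inv_closed rng_inv)
  then show "a = sP p"
    using a ginv_ginv [OF a] ginv_unit [OF moment_in_units [OF p]] by simp
next
  fix p assume p: "p \<in> topspace P"
  then show "act p (ginv G (sP p)) = p"
    by (simp add: ginv_unit moment_in_units unit_act)
next
  fix a b p
  assume "a \<in> topspace (arrows G)" "b \<in> topspace (arrows G)" "p \<in> topspace P"
    "src G a = rng G b" "src G b = sP p"
  then show "act (act p (ginv G b)) (ginv G a) = act p (ginv G (gmult G a b))"
    by (simp add: ginv_gmult mult_act inv_closed rng_inv src_inv)
next
  show "compact_preimages (left_fibre_product G P sP) (prod_topology P P)
          (\<lambda>(a, p). (act p (ginv G a), p))"
    unfolding compact_preimages_def
  proof (intro allI impI)
    fix K assume "compactin (prod_topology P P) K"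
    then have "compactin (right_fibre_product G P sP)
        {x \<in> topspace (right_fibre_product G P sP). (case x of (p, a) \<Rightarrow> (act p a, p)) \<in> K}"
      using proper by (simp add: compact_preimages_def)
    \<comment> \<open>For properness, the preimage of \<open>K\<close> under the new action map is
      the image, under the continuous swap, of the compact preimage of \<open>K\<close> under the
      old one.\<close>
    then have "compactin (left_fibre_product G P sP) ((\<lambda>(p, a). (ginv G a, p)) `
        {x \<in> topspace (right_fibre_product G P sP). (case x of (p, a) \<Rightarrow> (act p a, p)) \<in> K})"
      by (rule image_compactin [OF _ continuous_map_right_to_left_fibre_product])
    also have "(\<lambda>(p, a). (ginv G a, p)) `
        {x \<in> topspace (right_fibre_product G P sP). (case x of (p, a) \<Rightarrow> (act p a, p)) \<in> K} =
        {x \<in> topspace (left_fibre_product G P sP).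
          (case x of (a, p) \<Rightarrow> (act p (ginv G a), p)) \<in> K}"
      (is "?f ` ?A = ?B")
    proof
      show "?f ` ?A \<subseteq> ?B"
        by (auto simp: topspace_left_fibre_product topspace_right_fibre_product
            inv_closed src_inv ginv_ginv)
      show "?B \<subseteq> ?f ` ?A"
      proof
        fix x assume "x \<in> ?B"
        then obtain a p where "x = (a, p)" "(p, ginv G a) \<in> ?A" "a \<in> topspace (arrows G)"
          by (auto simp: topspace_left_fibre_product topspace_right_fibre_product
              inv_closed rng_inv)
        then show "x \<in> ?f ` ?A"
          by (auto intro!: image_eqI [of _ _ "(p, ginv G a)"] simp: ginv_ginv)
      qed
    qed
    finally show "compactin (left_fibre_product G P sP) ?B" .
  qed
qed

text \<open>Mirror image of the preceding construction; both are needed to exchange the roles of the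
  two groupoids in an equivalence.\<close>

lemma (in free_proper_left_action) free_proper_right_action_inverse:
  "free_proper_right_action G P rP (\<lambda>p a. act (ginv G a) p)"
proof
  show "continuous_map P (unit_space G) rP"
    by (rule continuous_moment)
  show "continuous_map (right_fibre_product G P rP) P (\<lambda>(p, a). act (ginv G a) p)"
    using continuous_map_compose [OF continuous_map_right_to_left_fibre_product continuous_act]
    by (simp add: case_prod_unfold comp_def)
  fix a p
  assume a: "a \<in> topspace (arrows G)" and p: "p \<in> topspace P" and ap: "rP p = rng G a"
  show "rP (act (ginv G a) p) = src G a"
    using a p ap by (simp add: moment_act inv_closed rng_inv src_inv)
  assume "act (ginv G a) p = p"
  then have "ginv G a = rP p"
    using a p ap free [of "ginv G a" p] by (simp add: inv_closed src_inv)
  then show "a = rP p"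
    using a ginv_ginv [OF a] ginv_unit [OF moment_in_units [OF p]] by simp
next
  fix p assume p: "p \<in> topspace P"
  then show "act (ginv G (rP p)) p = p"
    by (simp add: ginv_unit moment_in_units unit_act)
next
  fix a b p
  assume "a \<in> topspace (arrows G)" "b \<in> topspace (arrows G)" "p \<in> topspace P"
    "rP p = rng G a" "src G a = rng G b"
  then show "act (ginv G b) (act (ginv G a) p) = act (ginv G (gmult G a b)) p"
    by (simp add: ginv_gmult mult_act inv_closed rng_inv src_inv)
next
  show "compact_preimages (right_fibre_product G P rP) (prod_topology P P)
          (\<lambda>(p, a). (act (ginv G a) p, p))"
    unfolding compact_preimages_def
  proof (intro allI impI)
    fix K assume "compactin (prod_topology P P) K"
    then have "compactin (left_fibre_product G P rP)
        {x \<in> topspace (left_fibre_product G P rP). (case x of (a, p) \<Rightarrow> (act a p, p)) \<in> K}"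
      using proper by (simp add: compact_preimages_def)
    then have "compactin (right_fibre_product G P rP) ((\<lambda>(a, p). (p, ginv G a)) `
        {x \<in> topspace (left_fibre_product G P rP). (case x of (a, p) \<Rightarrow> (act a p, p)) \<in> K})"
      by (rule image_compactin [OF _ continuous_map_left_to_right_fibre_product])
    also have "(\<lambda>(a, p). (p, ginv G a)) `
        {x \<in> topspace (left_fibre_product G P rP). (case x of (a, p) \<Rightarrow> (act a p, p)) \<in> K} =
        {x \<in> topspace (right_fibre_product G P rP).
          (case x of (p, a) \<Rightarrow> (act (ginv G a) p, p)) \<in> K}"
      (is "?f ` ?A = ?B")
    proof
      show "?f ` ?A \<subseteq> ?B"
        by (auto simp: topspace_left_fibre_product topspace_right_fibre_product
            inv_closed rng_inv ginv_ginv)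
      show "?B \<subseteq> ?f ` ?A"
      proof
        fix x assume "x \<in> ?B"
        then obtain a p where "x = (p, a)" "(ginv G a, p) \<in> ?A" "a \<in> topspace (arrows G)"
          by (auto simp: topspace_left_fibre_product topspace_right_fibre_product
              inv_closed src_inv)
        then show "x \<in> ?f ` ?A"
          by (auto intro!: image_eqI [of _ _ "(ginv G a, p)"] simp: ginv_ginv)
      qed
    qed
    finally show "compactin (right_fibre_product G P rP) ?B" .
  qed
qed

section \<open>Orbit spaces and closures in subspaces\<close>

lemma topspace_quotient_topology: "topspace (quotient_topology X q) = q ` topspace X"
proof
  show "topspace (quotient_topology X q) \<subseteq> q ` topspace X"
    using openin_topspace [of "quotient_topology X q"] unfolding openin_quotient_topology by blast
  have "{x \<in> topspace X. q x \<in> q ` topspace X} = topspace X"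
    by blast
  then have "openin (quotient_topology X q) (q ` topspace X)"
    by (simp add: openin_quotient_topology)
  then show "q ` topspace X \<subseteq> topspace (quotient_topology X q)"
    by (rule openin_subset)
qed

lemma induces_homeomorphism_image:
  assumes "induces_homeomorphism X q Y f"
  shows "f ` topspace X = topspace Y"
proof -
  obtain h where h: "homeomorphic_map (quotient_topology X q) Y h" "\<forall>x\<in>topspace X. h (q x) = f x"
    using assms by (auto simp: induces_homeomorphism_def)
  have "topspace Y = h ` q ` topspace X"
    using homeomorphic_imp_surjective_map [OF h(1)] by (simp add: topspace_quotient_topology)
  then show ?thesis
    using h(2) by (auto simp: image_image)
qed

text \<open>The induced map is injective on the quotient. For a moment map of an equivalence this
  turns equal moments into equal orbits.\<close>

lemma induces_homeomorphism_inj: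
  assumes "induces_homeomorphism X q Y f" "x \<in> topspace X" "y \<in> topspace X" "f x = f y"
  shows "q x = q y"
proof -
  obtain h where h: "homeomorphic_map (quotient_topology X q) Y h" "\<forall>x\<in>topspace X. h (q x) = f x"
    using assms by (auto simp: induces_homeomorphism_def)
  have "inj_on h (q ` topspace X)"
    using homeomorphic_imp_injective_map [OF h(1)] by (simp add: topspace_quotient_topology)
  then show ?thesis
    using h(2) assms inj_onD [of h "q ` topspace X" "q x" "q y"] by simp
qed

text \<open>Trades density inside a closed invariant set for a statement about the closure in the
  whole unit space, the form in which density is transferred.\<close>

lemma closure_of_subtopology_Collect:
  "subtopology X S closure_of {x \<in> S. P x} = S \<inter> X closure_of {x \<in> S. P x}"
proof -
  have "S \<inter> {x \<in> S. P x} = {x \<in> S. P x}"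
    by (rule Int_absorb1) simp
  then show ?thesis
    by (simp only: closure_of_subtopology)
qed

section \<open>Symmetry of equivalence, and fibres of the moment maps as orbits\<close>

context groupoid_equivalence
begin

text \<open>The opposite equivalence: the same space with both actions moved to the other side by
  inversion. Orbits are unchanged, so the homeomorphism conditions are simply exchanged. It reduces
  each equivalence of properties to one implication.\<close>

lemma symmetric_equivalence:
  "groupoid_equivalence H G Z sZ (\<lambda>b z. ract z (ginv H b)) rZ (\<lambda>z a. lact (ginv G a) z)"
proof (rule groupoid_equivalence.intro)
  show "free_proper_left_action H Z sZ (\<lambda>b z. ract z (ginv H b))"
    by (rule right.free_proper_left_action_inverse)
  show "free_proper_right_action G Z rZ (\<lambda>z a. lact (ginv G a) z)"
    by (rule left.free_proper_right_action_inverse)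
  show "groupoid_equivalence_axioms H G Z sZ (\<lambda>b z. ract z (ginv H b)) rZ (\<lambda>z a. lact (ginv G a) z)"
  proof
    show "induces_homeomorphism Z (right_orbit G rZ (\<lambda>z a. lact (ginv G a) z)) (unit_space H) sZ"
      by (simp add: left.right_orbit_inverse_action homeo_sZ)
    show "induces_homeomorphism Z (left_orbit H sZ (\<lambda>b z. ract z (ginv H b))) (unit_space G) rZ"
      by (simp add: right.left_orbit_inverse_action homeo_rZ)
  qed (simp_all add: locally_compact_Z Hausdorff_Z open_rZ open_sZ rZ_ract sZ_lact actions_commute
      left.inv_closed right.inv_closed left.src_inv right.rng_inv)
qed

lemma rZ_image: "rZ ` topspace Z = units G"
  using induces_homeomorphism_image [OF homeo_rZ] by simp

lemma sZ_image: "sZ ` topspace Z = units H"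
  using induces_homeomorphism_image [OF homeo_sZ] by simp

lemma ract_closed:
  assumes "z \<in> topspace Z" "b \<in> topspace (arrows H)" "sZ z = rng H b"
  shows "ract z b \<in> topspace Z"
  using continuous_map_image_subset_topspace [OF right.continuous_act] assms
  by (auto simp: right.topspace_right_fibre_product)

lemma lact_closed:
  assumes "z \<in> topspace Z" "a \<in> topspace (arrows G)" "src G a = rZ z"
  shows "lact a z \<in> topspace Z"
  using continuous_map_image_subset_topspace [OF left.continuous_act] assms
  by (auto simp: left.topspace_left_fibre_product)

text \<open>Equal values of \<open>sZ\<close> mean equal left orbits, and z' lies in its own orbit
  because the unit \<open>rZ z'\<close> fixes it.\<close>

lemma sZ_eq_imp_lact:
  assumes "z \<in> topspace Z" "z' \<in> topspace Z" "sZ z = sZ z'"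
  obtains a where "a \<in> topspace (arrows G)" "src G a = rZ z" "lact a z = z'"
proof -
  have u: "rZ z' \<in> units G"
    using assms(2) by (rule left.moment_in_units)
  then have "lact (rZ z') z' \<in> left_orbit G rZ lact z'"
    using left.units_subset_arrows left.src_unit [OF u] unfolding left_orbit_def by blast
  then have "z' \<in> left_orbit G rZ lact z'"
    by (simp only: left.unit_act [OF assms(2)])
  also have "left_orbit G rZ lact z' = left_orbit G rZ lact z"
    by (rule induces_homeomorphism_inj [OF homeo_sZ assms(2,1) assms(3) [symmetric]])
  finally show thesis
    using that by (auto simp: left_orbit_def)
qed

lemma rZ_eq_imp_ract:
  assumes "z \<in> topspace Z" "z' \<in> topspace Z" "rZ z = rZ z'"
  obtains b where "b \<in> topspace (arrows H)" "sZ z = rng H b" "ract z b = z'"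
proof -
  have u: "sZ z' \<in> units H"
    using assms(2) by (rule right.moment_in_units)
  then have "ract z' (sZ z') \<in> right_orbit H sZ ract z'"
    using right.units_subset_arrows right.rng_unit [OF u, symmetric] unfolding right_orbit_def
    by blast
  then have "z' \<in> right_orbit H sZ ract z'"
    by (simp only: right.unit_act [OF assms(2)])
  also have "right_orbit H sZ ract z' = right_orbit H sZ ract z"
    by (rule induces_homeomorphism_inj [OF homeo_rZ assms(2,1) assms(3) [symmetric]])
  finally show thesis
    using that by (auto simp: right_orbit_def)
qed

section \<open>Transfer of discretely trivial isotropy\<close>

lemma continuous_map_rng: "continuous_map (arrows H) (unit_space H) (rng H)"
proof -
  have "continuous_map (arrows H) (composable_pairs H) (\<lambda>a. (a, ginv H a))"
    unfolding composable_pairs_def continuous_map_in_subtopology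
    by (auto intro!: continuous_map_pairedI right.continuous_inv simp: right.rng_inv)
  from continuous_map_compose [OF this right.continuous_mult]
  have "continuous_map (arrows H) (arrows H) (rng H)"
    by (rule continuous_map_eq) (simp add: right.right_inv)
  then show ?thesis
    by (auto simp: unit_space_def continuous_map_in_subtopology right.rng_in_units)
qed

text \<open>The unit space of \<open>H\<close> is Hausdorff, so the set where the two continuous
  maps \<open>sZ\<close> and \<open>rng H\<close> agree is closed in the product; it meets the
  compact set \<open>W \<times> K\<close> in a compact set.\<close>

lemma compactin_fibre_product:
  assumes "Hausdorff_space (arrows H)" "compactin Z W" "compactin (arrows H) K"
  shows "compactin (right_fibre_product H Z sZ) ((W \<times> K) \<inter> {(p, b). sZ p = rng H b})"
proof -
  let ?X = "prod_topology Z (arrows H)"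
  have "Hausdorff_space (unit_space H)"
    using assms(1) by (simp add: unit_space_def Hausdorff_space_subtopology)
  moreover have "continuous_map ?X (unit_space H) (\<lambda>x. sZ (fst x))"
    using continuous_map_compose [OF continuous_map_fst right.continuous_moment]
    by (simp add: comp_def)
  moreover have "continuous_map ?X (unit_space H) (\<lambda>x. rng H (snd x))"
    using continuous_map_compose [OF continuous_map_snd continuous_map_rng]
    by (simp add: comp_def)
  ultimately have closed: "closedin ?X {x \<in> topspace ?X. sZ (fst x) = rng H (snd x)}"
    by (rule closedin_continuous_maps_eq)
  have "compactin ?X (W \<times> K)"
    using assms by (simp add: compactin_Times)
  then have "compactin ?X ({x \<in> topspace ?X. sZ (fst x) = rng H (snd x)} \<inter> (W \<times> K))"
    by (rule closed_Int_compactin [OF closed])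
  also have "{x \<in> topspace ?X. sZ (fst x) = rng H (snd x)} \<inter> (W \<times> K) =
      (W \<times> K) \<inter> {(p, b). sZ p = rng H b}"
    using compactin_subset_topspace [OF assms(2)] compactin_subset_topspace [OF assms(3)] by auto
  finally show ?thesis
    by (simp add: right_fibre_product_def compactin_subtopology)
qed

lemma isotropy_discretely_trivial_transfer:
  assumes HH: "Hausdorff_space (arrows H)"
    and z: "z \<in> topspace Z" and triv: "isotropy_discretely_trivial_at G (rZ z)"
  shows "isotropy_discretely_trivial_at H (sZ z)"
  unfolding isotropy_discretely_trivial_at_def
proof (intro conjI allI impI)
  show "sZ z \<in> units H"
    using z by (rule right.moment_in_units)
  fix K assume K: "compactin (arrows H) K"
  obtain U W where U: "openin Z U" "z \<in> U" "U \<subseteq> W" and W: "compactin Z W"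
    using locally_compact_Z z unfolding locally_compact_space_def by blast
  \<comment> \<open>All translates of points of \<open>W\<close> by composable arrows of
    \<open>K\<close>: the place where the points p b will lie.\<close>
  define M where "M = (\<lambda>(p, b). ract p b) ` ((W \<times> K) \<inter> {(p, b). sZ p = rng H b})"
  have "compactin Z M"
    unfolding M_def
    by (rule image_compactin [OF compactin_fibre_product [OF HH W K] right.continuous_act])
  then have "compactin (prod_topology Z Z) (M \<times> W)"
    using W by (simp add: compactin_Times)
  \<comment> \<open>\<open>?T\<close> consists of the pairs (a, p) with p in \<open>W\<close> and a
    p in \<open>M\<close>. Its projection to \<open>G\<close> is the compact set on which the
    hypothesis at \<open>rZ z\<close> is tested.\<close>
  then have "compactin (left_fibre_product G Z rZ)
      {x \<in> topspace (left_fibre_product G Z rZ). (case x of (a, p) \<Rightarrow> (lact a p, p)) \<in> M \<times> W}"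
    (is "compactin _ ?T")
    using left.proper by (simp add: compact_preimages_def)
  then have "compactin (arrows G) (fst ` ?T)"
    by (rule image_compactin)
      (auto simp: left_fibre_product_def intro: continuous_map_from_subtopology continuous_map_fst)
  then obtain V where V: "openin (unit_space G) V" "rZ z \<in> V"
    and VT: "\<And>u. u \<in> V \<Longrightarrow> fst ` ?T \<inter> isotropy_group G u \<subseteq> {u}"
    using triv unfolding isotropy_discretely_trivial_at_def by meson
  \<comment> \<open>On \<open>U'\<close> both controls hold: p lies in \<open>W\<close>, and the
    isotropy at \<open>rZ p\<close> meets the test set at most in the unit. Openness of
    \<open>sZ\<close> makes its image the required neighbourhood.\<close>
  define U' where "U' = U \<inter> {x \<in> topspace Z. rZ x \<in> V}"
  have "openin Z U'"
    unfolding U'_def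
    by (intro openin_Int U openin_continuous_map_preimage [OF left.continuous_moment V(1)])
  then have "openin (unit_space H) (sZ ` U')"
    using open_sZ by (simp add: open_map_def)
  moreover have "sZ z \<in> sZ ` U'"
    using U V z by (simp add: U'_def)
  moreover have "K \<inter> isotropy_group H w \<subseteq> {w}" if "w \<in> sZ ` U'" for w
  proof
    fix b assume b: "b \<in> K \<inter> isotropy_group H w"
    then have bH: "b \<in> topspace (arrows H)" and bK: "b \<in> K" and bw: "rng H b = w" "src H b = w"
      by (auto simp: isotropy_group_def)
    obtain p where p: "p \<in> U" "p \<in> topspace Z" "rZ p \<in> V" "w = sZ p"
      using \<open>w \<in> sZ ` U'\<close> unfolding U'_def by blast
    \<comment> \<open>As b is isotropy at \<open>sZ p\<close>, acting by it changes neither moment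
      of p. Equality of the \<open>sZ\<close> values yields an arrow a with a p = p b, and equality
      of the \<open>rZ\<close> values makes a isotropy.\<close>
    have pb: "ract p b \<in> topspace Z" "sZ (ract p b) = sZ p" "rZ (ract p b) = rZ p"
      using p bH bw by (simp_all add: ract_closed right.moment_act rZ_ract)
    obtain a where a: "a \<in> topspace (arrows G)" "src G a = rZ p" "lact a p = ract p b"
      using sZ_eq_imp_lact [OF p(2) pb(1)] pb(2) by metis
    have "rng G a = rZ p"
      using left.moment_act [OF a(1) p(2) a(2)] a(3) pb(3) by simp
    then have "a \<in> isotropy_group G (rZ p)"
      using a by (simp add: isotropy_group_def)
    moreover have "a \<in> fst ` ?T"
    proof -
      have "(p, b) \<in> (W \<times> K) \<inter> {(p, b). sZ p = rng H b}"
        using p bK bw U(3) by auto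
      then have "(\<lambda>(p, b). ract p b) (p, b) \<in> M"
        unfolding M_def by (rule imageI)
      then have "(a, p) \<in> ?T"
        using a p U(3) by (auto simp: left.topspace_left_fibre_product)
      then have "fst (a, p) \<in> fst ` ?T"
        by (rule imageI)
      then show ?thesis
        by simp
    qed
    ultimately have "a = rZ p"
      using subsetD [OF VT [OF p(3)], of a] by simp
    then have "ract p b = p"
      using a(3) left.unit_act [OF p(2)] by simp
    then show "b \<in> {w}"
      using right.free [OF bH p(2)] p(4) bw by simp
  qed
  ultimately show "\<exists>V. openin (unit_space H) V \<and> sZ z \<in> V \<and>
      (\<forall>u\<in>V. K \<inter> isotropy_group H u \<subseteq> {u})"
    by (intro exI [of _ "sZ ` U'"] conjI ballI)
qed

section \<open>Correspondence of closed invariant sets\<close>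

definition corresponding :: "'h set \<Rightarrow> 'g set" where
  "corresponding F = rZ ` {z \<in> topspace Z. sZ z \<in> F}"

text \<open>Two points with the same \<open>rZ\<close> differ by an arrow b of \<open>H\<close>, and
  their \<open>sZ\<close> values are the range and source of b. Invariance of F thus makes the
  preimage of F under \<open>sZ\<close> a union of fibres of \<open>rZ\<close>, so any
  representative decides membership.\<close>

lemma rZ_in_corresponding_iff:
  assumes F: "invariant_subset H F" and z: "z \<in> topspace Z"
  shows "rZ z \<in> corresponding F \<longleftrightarrow> sZ z \<in> F"
proof
  assume "rZ z \<in> corresponding F"
  then obtain y where y: "y \<in> topspace Z" "sZ y \<in> F" "rZ y = rZ z"
    by (auto simp: corresponding_def)
  obtain b where b: "b \<in> topspace (arrows H)" "sZ y = rng H b" "ract y b = z"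
    using rZ_eq_imp_ract [OF y(1) z y(3)] by metis
  have "sZ z = src H b"
    using right.moment_act [OF b(1) y(1) b(2)] b(3) by simp
  then show "sZ z \<in> F"
    using F b y by (auto simp: invariant_subset_def)
qed (use z in \<open>auto simp: corresponding_def\<close>)

lemma corresponding_units: "corresponding (units H) = units G"
proof -
  have "{z \<in> topspace Z. sZ z \<in> units H} = topspace Z"
    using right.moment_in_units by blast
  then show ?thesis
    by (simp add: corresponding_def rZ_image)
qed

text \<open>If \<open>src G a = rZ z\<close> then \<open>rng G a = rZ (lact a z)\<close>, while
  \<open>sZ\<close> takes the same value at z and at \<open>lact a z\<close>.\<close>

lemma invariant_corresponding:
  assumes "invariant_subset H F"
  shows "invariant_subset G (corresponding F)"
  unfolding invariant_subset_def
proof (intro conjI ballI)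
  show "corresponding F \<subseteq> units G"
    by (auto simp: corresponding_def left.moment_in_units)
  fix a assume a: "a \<in> topspace (arrows G)"
  obtain z where z: "z \<in> topspace Z" "src G a = rZ z"
    using left.src_in_units [OF a] rZ_image by (metis imageE)
  have "rng G a \<in> corresponding F \<longleftrightarrow> sZ (lact a z) \<in> F"
    using rZ_in_corresponding_iff [OF assms lact_closed [OF z(1) a z(2)]]
    by (simp add: left.moment_act [OF a z])
  then show "rng G a \<in> corresponding F \<longleftrightarrow> src G a \<in> corresponding F"
    by (simp add: sZ_lact [OF a z] z rZ_in_corresponding_iff [OF assms z(1)])
qed

text \<open>Since the preimage of F is a union of fibres of \<open>rZ\<close>, the complement of
  \<open>corresponding F\<close> is the image under the open map \<open>rZ\<close> of the open set
  lying over the complement of F.\<close>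

lemma closedin_corresponding:
  assumes "invariant_subset H F" "closedin (unit_space H) F"
  shows "closedin (unit_space G) (corresponding F)"
proof -
  have "openin Z {z \<in> topspace Z. sZ z \<in> units H - F}"
    using assms(2)
    by (intro openin_continuous_map_preimage [OF right.continuous_moment]) (simp add: closedin_def)
  then have "openin (unit_space G) (rZ ` {z \<in> topspace Z. sZ z \<in> units H - F})"
    using open_rZ by (simp add: open_map_def)
  also have "rZ ` {z \<in> topspace Z. sZ z \<in> units H - F} = units G - corresponding F"
  proof
    show "rZ ` {z \<in> topspace Z. sZ z \<in> units H - F} \<subseteq> units G - corresponding F"
      by (auto simp: left.moment_in_units rZ_in_corresponding_iff [OF assms(1)])
    show "units G - corresponding F \<subseteq> rZ ` {z \<in> topspace Z. sZ z \<in> units H - F}"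
      unfolding rZ_image [symmetric]
      by (auto simp: rZ_in_corresponding_iff [OF assms(1)] right.moment_in_units)
  qed
  finally show ?thesis
    using invariant_corresponding [OF assms(1)] by (simp add: closedin_def invariant_subset_def)
qed

section \<open>Transfer of density and of the two principality conditions\<close>

text \<open>A neighbourhood T of \<open>sZ z\<close> is pulled back to \<open>Z\<close> and pushed
  forward by the open map \<open>rZ\<close> to a neighbourhood of \<open>rZ z\<close>. A point with
  discretely trivial isotropy found there has the form \<open>rZ x\<close> with \<open>sZ x\<close>
  in T, and \<open>sZ x\<close> is the point sought.\<close>

lemma dense_discretely_trivial_transfer:
  assumes HH: "Hausdorff_space (arrows H)" and F: "invariant_subset H F"
    and dense: "corresponding F \<subseteq> unit_space G closure_of
          {u \<in> corresponding F. isotropy_discretely_trivial_at G u}"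
  shows "F \<subseteq> unit_space H closure_of {v \<in> F. isotropy_discretely_trivial_at H v}"
proof
  fix v assume v: "v \<in> F"
  then have vH: "v \<in> units H"
    using F by (auto simp: invariant_subset_def)
  then obtain z where z: "z \<in> topspace Z" "v = sZ z"
    using sZ_image by (metis imageE)
  have "\<exists>y. y \<in> {v \<in> F. isotropy_discretely_trivial_at H v} \<and> y \<in> T"
    if T: "v \<in> T" "openin (unit_space H) T" for T
  proof -
    have "openin Z {x \<in> topspace Z. sZ x \<in> T}"
      by (rule openin_continuous_map_preimage [OF right.continuous_moment T(2)])
    then have "openin (unit_space G) (rZ ` {x \<in> topspace Z. sZ x \<in> T})"
      using open_rZ by (simp add: open_map_def)
    moreover have "rZ z \<in> rZ ` {x \<in> topspace Z. sZ x \<in> T}"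
      using z T by auto
    moreover have "rZ z \<in> corresponding F"
      using v z by (simp add: rZ_in_corresponding_iff [OF F])
    then have "rZ z \<in> unit_space G closure_of
        {u \<in> corresponding F. isotropy_discretely_trivial_at G u}"
      by (rule subsetD [OF dense])
    ultimately have "\<exists>u. u \<in> {u \<in> corresponding F. isotropy_discretely_trivial_at G u} \<and>
        u \<in> rZ ` {x \<in> topspace Z. sZ x \<in> T}"
      by (simp only: in_closure_of)
    then obtain x where x: "x \<in> topspace Z" "sZ x \<in> T" "rZ x \<in> corresponding F"
        "isotropy_discretely_trivial_at G (rZ x)"
      by blast
    then show ?thesis
      using isotropy_discretely_trivial_transfer [OF HH x(1,4)]
      by (intro exI [of _ "sZ x"]) (simp add: rZ_in_corresponding_iff [OF F])
  qed
  then show "v \<in> unit_space H closure_of {v \<in> F. isotropy_discretely_trivial_at H v}"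
    using vH by (simp add: in_closure_of)
qed

lemma strongly_topologically_principal_transfer:
  assumes "Hausdorff_space (arrows H)" "strongly_topologically_principal G"
  shows "strongly_topologically_principal H"
proof -
  \<comment> \<open>Topological principality is the case where F is the whole unit space, which
    corresponds to the whole unit space of \<open>G\<close>.\<close>
  have "invariant_subset H (units H)"
    by (auto simp: invariant_subset_def right.rng_in_units right.src_in_units)
  from dense_discretely_trivial_transfer [OF assms(1) this]
  have "units H \<subseteq> unit_space H closure_of {v \<in> units H. isotropy_discretely_trivial_at H v}"
    using assms(2) by (simp add: corresponding_units strongly_topologically_principal_def)
  then show ?thesis
    unfolding strongly_topologically_principal_def
    by (intro equalityI closure_of_subset_topspace [of "unit_space H", simplified])
qed

lemma strongly_essentially_principal_transfer:
  assumes "Hausdorff_space (arrows H)" "strongly_essentially_principal G"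
  shows "strongly_essentially_principal H"
  unfolding strongly_essentially_principal_def
proof (intro allI impI)
  fix F assume F: "closedin (unit_space H) F \<and> invariant_subset H F"
  let ?F = "corresponding F"
  have "closedin (unit_space G) ?F \<and> invariant_subset G ?F"
    using F invariant_corresponding closedin_corresponding by simp
  then have "subtopology (unit_space G) ?F closure_of
      {u \<in> ?F. isotropy_discretely_trivial_at G u} = ?F"
    by (rule assms(2) [unfolded strongly_essentially_principal_def, rule_format])
  \<comment> \<open>The subspace closure is \<open>?F\<close> intersected with the ambient closure,
    so its equality with \<open>?F\<close> says exactly that \<open>?F\<close> lies in the ambient
    closure.\<close>
  then have "?F \<subseteq> unit_space G closure_of {u \<in> ?F. isotropy_discretely_trivial_at G u}"
    unfolding closure_of_subtopology_Collect by (simp only: inf.absorb_iff1)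
  then have "F \<subseteq> unit_space H closure_of {v \<in> F. isotropy_discretely_trivial_at H v}"
    using F by (intro dense_discretely_trivial_transfer [OF assms(1)]) simp_all
  then show "subtopology (unit_space H) F closure_of {v \<in> F. isotropy_discretely_trivial_at H v} = F"
    unfolding closure_of_subtopology_Collect by (rule Int_absorb2)
qed

end

theorem theorem3p14:
  fixes G :: "'g groupoid_data" and H :: "'h groupoid_data" and Z :: "'z topology"
    and rZ :: "'z \<Rightarrow> 'g" and lact :: "'g \<Rightarrow> 'z \<Rightarrow> 'z"
    and sZ :: "'z \<Rightarrow> 'h" and ract :: "'z \<Rightarrow> 'h \<Rightarrow> 'z"
  assumes "topological_groupoid G"
    and "locally_compact_space (arrows G)" and "Hausdorff_space (arrows G)"
    and "open_map (arrows G) (unit_space G) (rng G)"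
    and "open_map (arrows G) (unit_space G) (src G)"
    and "topological_groupoid H"
    and "locally_compact_space (arrows H)" and "Hausdorff_space (arrows H)"
    and "open_map (arrows H) (unit_space H) (rng H)"
    and "open_map (arrows H) (unit_space H) (src H)"
    and "groupoid_equivalence G H Z rZ lact sZ ract"
  shows "(strongly_topologically_principal G \<longleftrightarrow> strongly_topologically_principal H) \<and>
         (strongly_essentially_principal G \<longleftrightarrow> strongly_essentially_principal H)"
proof -
  interpret groupoid_equivalence G H Z rZ lact sZ ract
    by fact
  \<comment> \<open>The opposite equivalence supplies the implications from \<open>H\<close> to
    \<open>G\<close>. Each transfer uses the Hausdorff property of the groupoid it arrives
    at.\<close>
  interpret sym: groupoid_equivalence H G Z sZ "\<lambda>b z. ract z (ginv H b)" rZ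
      "\<lambda>z a. lact (ginv G a) z"
    by (rule symmetric_equivalence)
  note HG = \<open>Hausdorff_space (arrows G)\<close> and HH = \<open>Hausdorff_space (arrows H)\<close>
  show ?thesis
    using strongly_topologically_principal_transfer [OF HH]
      strongly_essentially_principal_transfer [OF HH]
      sym.strongly_topologically_principal_transfer [OF HG]
      sym.strongly_essentially_principal_transfer [OF HG]
    by argo
qed

end
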